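(* Assume the standing setting and assumption in the context. There exists a constant $C>0$ such that for any $\epsilon\ge0$ there exists $N\in\mathbb N$ such that for all $x\in\mathbb Z^d$ with $|x|_1\ge N$, $$\mathbb E\big[\nu_x[r,r+\epsilon]\big]\ \ge\ C\,\mu[r,r+\epsilon].$$
   Context: Setting: $d\ge2$; $\mathcal E^d$ nearest-neighbor edges of $\mathbb Z^d$; $\{\tau_e\}$ i.i.d. non-negative with law $\mu$, distribution function $F$, essential infimum $r$. Standing assumption: $F(r)<p_c(d)$ if $r=0$ and $F(r)<\vec p_c(d)$ if $r>0$ ($p_c(d)$, $\vec p_c(d)$: critical probabilities of Bernoulli bond and oriented bond percolation on $\mathbb Z^d$). $T(\gamma)=\sum_{e\in\gamma}\tau_e$; geodesics from $x$ to $y$ are vertex self-avoiding paths minimizing $T$. Fix a deterministic ordering of all finite vertex self-avoiding paths; $\pi^{(x)}$ is the first geodesic from $0$ to $x$ in it. $\nu_x(B)=\frac{1}{|\pi^{(x)}|}\#\{e\in\pi^{(x)}:\tau_e\in B\}$. *)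

theory Defs
  imports "HOL-Probability.Probability"
begin

definition l1norm :: "int list \<Rightarrow> int" where
  "l1norm x = sum_list (map abs x)"

definition verts :: "nat \<Rightarrow> int list set" where
  "verts d = {x. length x = d}"

definition origin :: "nat \<Rightarrow> int list" where
  "origin d = replicate d 0"

definition adj :: "int list \<Rightarrow> int list \<Rightarrow> bool" where
  "adj x y \<longleftrightarrow> length x = length y \<and> l1norm (map2 (-) x y) = 1"

definition edges :: "nat \<Rightarrow> int list set set" where
  "edges d = {{x, y} | x y. x \<in> verts d \<and> y \<in> verts d \<and> adj x y}"

definition bond_measure :: "nat \<Rightarrow> real \<Rightarrow> (int list set \<Rightarrow> bool) measure" where
  "bond_measure d p = PiM (edges d) (\<lambda>_. measure_pmf (bernoulli_pmf p))"

definition open_cluster :: "nat \<Rightarrow> (int list set \<Rightarrow> bool) \<Rightarrow> int list set" where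
  "open_cluster d \<omega> =
     {y. (origin d, y) \<in> {(x, z). x \<in> verts d \<and> z \<in> verts d \<and> adj x z \<and> \<omega> {x, z}}\<^sup>*}"

definition theta :: "nat \<Rightarrow> real \<Rightarrow> real" where
  "theta d p = measure (bond_measure d p)
     {\<omega> \<in> space (bond_measure d p). infinite (open_cluster d \<omega>)}"

definition p_c :: "nat \<Rightarrow> real" where
  "p_c d = Sup {p \<in> {0..1}. theta d p = 0}"

definition oriented_cluster :: "nat \<Rightarrow> (int list set \<Rightarrow> bool) \<Rightarrow> int list set" where
  "oriented_cluster d \<omega> =
     {y. (origin d, y) \<in> {(x, z). x \<in> verts d \<and> (\<exists>i<d. z = x[i := x ! i + 1]) \<and> \<omega> {x, z}}\<^sup>*}"

definition oriented_theta :: "nat \<Rightarrow> real \<Rightarrow> real" where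
  "oriented_theta d p = measure (bond_measure d p)
     {\<omega> \<in> space (bond_measure d p). infinite (oriented_cluster d \<omega>)}"

definition oriented_p_c :: "nat \<Rightarrow> real" where
  "oriented_p_c d = Sup {p \<in> {0..1}. oriented_theta d p = 0}"

definition distrF :: "real measure \<Rightarrow> real \<Rightarrow> real" where
  "distrF \<mu> t = measure \<mu> {..t}"

definition ess_inf_r :: "real measure \<Rightarrow> real" where
  "ess_inf_r \<mu> = Inf {t. 0 < distrF \<mu> t}"

definition fpp_measure :: "nat \<Rightarrow> real measure \<Rightarrow> (int list set \<Rightarrow> real) measure" where
  "fpp_measure d \<mu> = PiM (edges d) (\<lambda>_. \<mu>)"

definition sa_path :: "nat \<Rightarrow> int list list \<Rightarrow> int list \<Rightarrow> int list \<Rightarrow> bool" where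
  "sa_path d p x y \<longleftrightarrow> p \<noteq> [] \<and> hd p = x \<and> last p = y \<and> distinct p \<and> set p \<subseteq> verts d \<and>
     (\<forall>i. Suc i < length p \<longrightarrow> adj (p ! i) (p ! Suc i))"

definition path_edges :: "int list list \<Rightarrow> int list set list" where
  "path_edges p = map (\<lambda>i. {p ! i, p ! Suc i}) [0..<length p - 1]"

definition passage_time :: "(int list set \<Rightarrow> real) \<Rightarrow> int list list \<Rightarrow> real" where
  "passage_time \<omega> p = sum_list (map \<omega> (path_edges p))"

definition geodesic :: "nat \<Rightarrow> (int list set \<Rightarrow> real) \<Rightarrow> int list \<Rightarrow> int list list \<Rightarrow> bool" where
  "geodesic d \<omega> x p \<longleftrightarrow> sa_path d p (origin d) x \<and>
     (\<forall>q. sa_path d q (origin d) x \<longrightarrow> passage_time \<omega> p \<le> passage_time \<omega> q)"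

text \<open>First geodesic from 0 to x in the fixed deterministic ordering, given by an
  injective enumeration ord of all finite vertex lists.\<close>
definition first_geodesic ::
  "nat \<Rightarrow> (int list list \<Rightarrow> nat) \<Rightarrow> (int list set \<Rightarrow> real) \<Rightarrow> int list \<Rightarrow> int list list" where
  "first_geodesic d ord \<omega> x = arg_min ord (geodesic d \<omega> x)"

definition nu :: "nat \<Rightarrow> (int list list \<Rightarrow> nat) \<Rightarrow> (int list set \<Rightarrow> real) \<Rightarrow> int list \<Rightarrow> real set \<Rightarrow> real" where
  "nu d ord \<omega> x B =
     (let \<pi> = first_geodesic d ord \<omega> x in
        real (length (filter (\<lambda>e. \<omega> e \<in> B) (path_edges \<pi>))) / real (length (path_edges \<pi>)))"

end

theory Submission
  imports Defs
begin

text \<open>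
  Fix an edge \<open>e\<close> and all weights except \<open>\<tau>\<^sub>e\<close>. If \<open>e\<close> lies on the first geodesic \<open>\<pi>\<close>, then lowering
  \<open>\<tau>\<^sub>e\<close> does not change \<open>\<pi>\<close>; hence the share \<open>1{e \<in> \<pi>} / |\<pi>|\<close> of \<open>e\<close> is a decreasing function of \<open>\<tau>\<^sub>e\<close>. So is the
  indicator of \<open>\<tau>\<^sub>e \<in> [r, r + \<epsilon>]\<close> on the support of \<open>\<mu>\<close>, and Chebyshev's association inequality gives
  \<open>E[1{e \<in> \<pi>, \<tau>\<^sub>e \<in> [r, r + \<epsilon>]} / |\<pi>|] \<ge> \<mu>[r, r + \<epsilon>] E[1{e \<in> \<pi>} / |\<pi>|]\<close>. As the shares sum to \<open>1\<close>,
  summing over \<open>e\<close> proves the bound with \<open>C = 1\<close> for every \<open>x \<noteq> 0\<close>, provided that geodesics exist almost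
  surely. They do, because for some \<open>\<delta> > 0\<close> all clusters of edges with weight at most \<open>\<delta>\<close> are
  finite almost surely: by subcriticality if \<open>r = 0\<close>, and trivially with \<open>\<delta> < r\<close> if \<open>r > 0\<close>.
\<close>

subsection \<open>Lattice paths\<close>

lemma verts_length: "x \<in> verts d \<longleftrightarrow> length x = d"
  by (simp add: verts_def)

lemma origin_in_verts: "origin d \<in> verts d"
  by (simp add: origin_def verts_def)

lemma countable_edges: "countable (edges d)"
proof -
  have "edges d \<subseteq> (\<lambda>(x, y). {x, y}) ` (UNIV :: (int list \<times> int list) set)"
    by (auto simp: edges_def)
  then show ?thesis
    by (rule countable_subset) auto
qed

lemma edgeI: "x \<in> verts d \<Longrightarrow> y \<in> verts d \<Longrightarrow> adj x y \<Longrightarrow> {x, y} \<in> edges d"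
  by (auto simp: edges_def)

lemma l1norm_nonneg: "0 \<le> l1norm x"
  by (auto simp: l1norm_def intro!: sum_list_nonneg)

lemma abs_le_l1norm: "a \<in> set x \<Longrightarrow> \<bar>a\<bar> \<le> l1norm x"
  unfolding l1norm_def by (rule member_le_sum_list) auto

text \<open>Neighbours differ by at most 1 in every coordinate, so they are lists of fixed length
  over a bounded range.\<close>

lemma finite_adj: "finite {y. adj x y}"
proof -
  let ?m = "l1norm x + 1"
  have "\<bar>y ! i\<bar> \<le> ?m" if "adj x y" "i < length y" for y i
  proof -
    have len: "length x = length y" and n: "l1norm (map2 (-) x y) = 1"
      using that by (auto simp: adj_def)
    have "map2 (-) x y ! i \<in> set (map2 (-) x y)"
      using that len by (intro nth_mem) auto
    from abs_le_l1norm[OF this] have "\<bar>x ! i - y ! i\<bar> \<le> 1"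
      using n that len by simp
    moreover have "\<bar>x ! i\<bar> \<le> l1norm x"
      using that len by (intro abs_le_l1norm) auto
    ultimately show ?thesis by linarith
  qed
  then have "{y. adj x y} \<subseteq> {y. set y \<subseteq> {-?m..?m} \<and> length y = length x}"
    by (fastforce simp: adj_def in_set_conv_nth abs_le_iff)
  then show ?thesis
    by (rule finite_subset) (intro finite_lists_length_eq, simp)
qed

lemma path_edges_snoc:
  assumes "p \<noteq> []"
  shows "path_edges (p @ [y]) = path_edges p @ [{last p, y}]"
proof -
  obtain n where n: "length p = Suc n"
    using assms by (cases p) auto
  have "last p = p ! n"
    using assms n by (simp add: last_conv_nth)
  then show ?thesis
    using n by (auto simp: path_edges_def nth_append)
qed

lemma passage_time_snoc:
  "p \<noteq> [] \<Longrightarrow> passage_time \<omega> (p @ [y]) = passage_time \<omega> p + \<omega> {last p, y}"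
  by (simp add: passage_time_def path_edges_snoc)

lemma sa_path_snoc_iff:
  assumes "p \<noteq> []"
  shows "sa_path d (p @ [y]) x y' \<longleftrightarrow>
    y' = y \<and> sa_path d p x (last p) \<and> adj (last p) y \<and> y \<in> verts d \<and> y \<notin> set p"
proof -
  have "(\<forall>i. Suc i < length (p @ [y]) \<longrightarrow> adj ((p @ [y]) ! i) ((p @ [y]) ! Suc i)) \<longleftrightarrow>
    (\<forall>i. Suc i < length p \<longrightarrow> adj (p ! i) (p ! Suc i)) \<and> adj (last p) y" (is "?L \<longleftrightarrow> ?R")
  proof
    assume L: ?L
    have "adj (p ! i) (p ! Suc i)" if "Suc i < length p" for i
      using spec[OF L, of i] that by (simp add: nth_append)
    moreover have "adj (last p) y"
      using spec[OF L, of "length p - 1"] assms by (simp add: nth_append last_conv_nth)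
    ultimately show ?R by blast
  next
    assume R: ?R
    show ?L
    proof (intro allI impI)
      fix i assume i: "Suc i < length (p @ [y])"
      show "adj ((p @ [y]) ! i) ((p @ [y]) ! Suc i)"
      proof (cases "Suc i < length p")
        case True
        then show ?thesis using R by (simp add: nth_append)
      next
        case False
        then have "i = length p - 1" using i by simp
        then show ?thesis using R assms by (simp add: nth_append last_conv_nth)
      qed
    qed
  qed
  then show ?thesis
    using assms by (auto simp: sa_path_def)
qed

lemma sa_path_edges: "sa_path d p x y \<Longrightarrow> set (path_edges p) \<subseteq> edges d"
  by (auto simp: sa_path_def path_edges_def intro!: edgeI)

text \<open>Edges are unordered pairs, so equality of two has a straight and a swapped case.
  Distinct vertices give \<open>i = j\<close> in the first and exclude the second, which would need
  \<open>i = Suc j\<close> and \<open>Suc i = j\<close>.\<close>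

lemma distinct_path_edges:
  assumes "distinct p"
  shows "distinct (path_edges p)"
  unfolding path_edges_def distinct_map
proof (intro conjI inj_onI)
  fix i j assume ij: "i \<in> set [0..<length p - 1]" "j \<in> set [0..<length p - 1]"
    and eq: "{p ! i, p ! Suc i} = {p ! j, p ! Suc j}"
  then have "i < length p" "Suc i < length p" "j < length p" "Suc j < length p" by auto
  then show "i = j"
    using eq assms by (auto simp: doubleton_eq_iff nth_eq_iff_index_eq)
qed simp

lemma passage_time_eq_sum:
  "distinct p \<Longrightarrow> passage_time \<omega> p = (\<Sum>e\<in>set (path_edges p). \<omega> e)"
  by (simp add: passage_time_def sum_list_distinct_conv_sum_set distinct_path_edges)

lemma sum_list_update_group:
  fixes xs :: "'a::ab_group_add list"
  shows "i < length xs \<Longrightarrow> sum_list (xs[i := a]) = sum_list xs + a - xs ! i"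
  by (induction xs arbitrary: i) (auto split: nat.splits)

text \<open>Induction on the norm: move one nonzero coordinate a unit towards 0 and append
  \<open>x\<close> to a path to that point. The norm bound is carried along because it shows that
  \<open>x\<close> is a new vertex.\<close>

lemma ex_sa_path:
  assumes "x \<in> verts d"
  shows "\<exists>p. sa_path d p (origin d) x \<and> (\<forall>v\<in>set p. l1norm v \<le> l1norm x)"
  using assms
proof (induction "nat (l1norm x)" arbitrary: x rule: less_induct)
  case less
  show ?case
  proof (cases "x = origin d")
    case True
    then have "sa_path d [x] (origin d) x"
      using less.prems by (simp add: sa_path_def)
    then show ?thesis by (intro exI[of _ "[x]"]) simp
  next
    case False
    then obtain i where i: "i < d" "x ! i \<noteq> 0"
      using less.prems by (auto simp: origin_def verts_length list_eq_iff_nth_eq)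
    define y where "y = x[i := x ! i - sgn (x ! i)]"
    have len: "length x = d" "length y = d"
      using less.prems by (auto simp: y_def verts_length)
    have "map abs y = (map abs x)[i := \<bar>x ! i\<bar> - 1]"
      using i by (auto simp: y_def map_update sgn_if)
    then have "l1norm y = l1norm x + (\<bar>x ! i\<bar> - 1) - \<bar>x ! i\<bar>"
      using i len unfolding l1norm_def by (simp add: sum_list_update_group)
    then have ny: "l1norm y = l1norm x - 1" by simp
    have "map2 (-) y x = (replicate d 0)[i := - sgn (x ! i)]"
      using len i by (intro nth_equalityI) (auto simp: y_def nth_list_update)
    then have "map abs (map2 (-) y x) = (replicate d 0)[i := 1]"
      using i by (simp add: map_update sgn_if)
    then have "l1norm (map2 (-) y x) = sum_list ((replicate d 0)[i := 1])"
      unfolding l1norm_def by simp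
    also have "\<dots> = 1"
      using i by (subst sum_list_update_group) (auto simp: sum_list_replicate)
    finally have adj: "adj y x"
      using len by (simp add: adj_def)
    obtain p where p: "sa_path d p (origin d) y" "\<forall>v\<in>set p. l1norm v \<le> l1norm y"
      using less.hyps[of y] ny l1norm_nonneg[of y] len by (auto simp: verts_length)
    have "p \<noteq> []" "last p = y"
      using p by (auto simp: sa_path_def)
    moreover have "x \<notin> set p"
      using p(2) ny by force
    ultimately have "sa_path d (p @ [x]) (origin d) x"
      using p(1) adj less.prems by (simp add: sa_path_snoc_iff)
    then show ?thesis
      using p(2) ny by (intro exI[of _ "p @ [x]"]) force
  qed
qed

subsection \<open>Existence of geodesics\<close>

text \<open>Kept as a relation, so that the cluster of \<open>v\<close> in the light edges is the
  image of \<open>{v}\<close> under its reflexive transitive closure.\<close>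

definition light_steps :: "nat \<Rightarrow> real \<Rightarrow> (int list set \<Rightarrow> real) \<Rightarrow> (int list \<times> int list) set" where
  "light_steps d \<delta> \<omega> = {(x, z). x \<in> verts d \<and> z \<in> verts d \<and> adj x z \<and> \<omega> {x, z} \<le> \<delta>}"

text \<open>The index is a budget of edges that may be heavier than \<delta>: each
  \<open>Suc\<close> allows one arbitrary lattice edge and then completes the light clusters
  again.\<close>

fun light_reach :: "nat \<Rightarrow> real \<Rightarrow> (int list set \<Rightarrow> real) \<Rightarrow> nat \<Rightarrow> int list set" where
  "light_reach d \<delta> \<omega> 0 = (light_steps d \<delta> \<omega>)\<^sup>* `` {origin d}"
| "light_reach d \<delta> \<omega> (Suc k) =
     (light_steps d \<delta> \<omega>)\<^sup>* ``
       (light_reach d \<delta> \<omega> k \<union> (\<Union>x\<in>light_reach d \<delta> \<omega> k. {y \<in> verts d. adj x y}))"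

lemma light_steps_rtrancl_verts:
  "(x, y) \<in> (light_steps d \<delta> \<omega>)\<^sup>* \<Longrightarrow> x \<in> verts d \<Longrightarrow> y \<in> verts d"
  by (induction rule: rtrancl_induct) (auto simp: light_steps_def)

lemma light_reach_verts: "light_reach d \<delta> \<omega> k \<subseteq> verts d"
  by (induction k) (auto dest: light_steps_rtrancl_verts simp: origin_in_verts)

text \<open>Each stage is a union of finitely many finite clusters, since a finite set has finitely
  many neighbours.\<close>

lemma finite_light_reach:
  assumes "\<And>v. v \<in> verts d \<Longrightarrow> finite ((light_steps d \<delta> \<omega>)\<^sup>* `` {v})"
  shows "finite (light_reach d \<delta> \<omega> k)"
proof -
  have *: "finite ((light_steps d \<delta> \<omega>)\<^sup>* `` A)" if "finite A" "A \<subseteq> verts d" for A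
  proof -
    have "(light_steps d \<delta> \<omega>)\<^sup>* `` A = (\<Union>v\<in>A. (light_steps d \<delta> \<omega>)\<^sup>* `` {v})" by auto
    then show ?thesis using that assms by auto
  qed
  show ?thesis
  proof (induction k)
    case 0
    show ?case by (simp add: assms origin_in_verts)
  next
    case (Suc k)
    have "finite {y \<in> verts d. adj x y}" for x
      by (rule finite_subset[OF _ finite_adj[of x]]) auto
    then show ?case
      unfolding light_reach.simps using Suc light_reach_verts[of d \<delta> \<omega> k]
      by (intro *) auto
  qed
qed

lemma light_reach_closed:
  assumes "x \<in> light_reach d \<delta> \<omega> k" "(x, y) \<in> light_steps d \<delta> \<omega>"
  shows "y \<in> light_reach d \<delta> \<omega> k"
  using assms by (cases k) (simp_all, (blast intro: rtrancl_into_rtrancl)+)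

lemma light_reach_Suc:
  "x \<in> light_reach d \<delta> \<omega> k \<Longrightarrow> y \<in> verts d \<Longrightarrow> adj x y \<Longrightarrow> y \<in> light_reach d \<delta> \<omega> (Suc k)"
  by auto

lemma passage_time_nonneg:
  assumes "\<And>e. e \<in> edges d \<Longrightarrow> 0 \<le> \<omega> e" "sa_path d p x y"
  shows "0 \<le> passage_time \<omega> p"
  unfolding passage_time_def
  using assms(1) sa_path_edges[OF assms(2)] by (intro sum_list_nonneg) auto

text \<open>A path of passage time at most \<open>k \<delta>\<close> has at most \<open>k\<close> edges heavier than \<open>\<delta>\<close>, so
  it stays in the finite set of vertices reachable from the origin with \<open>k\<close> such edges.\<close>

lemma sa_path_in_light_reach:
  assumes nonneg: "\<And>e. e \<in> edges d \<Longrightarrow> 0 \<le> \<omega> e" and "\<delta> > 0"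
    and "sa_path d p (origin d) y" and "passage_time \<omega> p \<le> real k * \<delta>"
  shows "set p \<subseteq> light_reach d \<delta> \<omega> k"
  using assms(3,4)
proof (induction p arbitrary: y k rule: rev_induct)
  case Nil
  then show ?case by simp
next
  case (snoc z p)
  show ?case
  proof (cases "p = []")
    case True
    then have "z = origin d"
      using snoc.prems by (simp add: sa_path_def)
    moreover have "origin d \<in> light_reach d \<delta> \<omega> k"
      by (induction k) auto
    ultimately show ?thesis using True by simp
  next
    case False
    let ?l = "last p"
    have p: "sa_path d p (origin d) ?l" "adj ?l z" "z \<in> verts d"
      using snoc.prems(1) False by (auto simp: sa_path_snoc_iff)
    have l: "?l \<in> verts d" "?l \<in> set p"
      using p(1) False by (auto simp: sa_path_def)
    have T: "passage_time \<omega> p + \<omega> {?l, z} \<le> real k * \<delta>"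
      using snoc.prems(2) False by (simp add: passage_time_snoc)
    have "0 \<le> \<omega> {?l, z}"
      using p l by (intro nonneg edgeI)
    then have sub: "set p \<subseteq> light_reach d \<delta> \<omega> k"
      using T by (intro snoc.IH[OF p(1)]) simp
    have "z \<in> light_reach d \<delta> \<omega> k"
    proof (cases "\<omega> {?l, z} \<le> \<delta>")
      case True
      then have "(?l, z) \<in> light_steps d \<delta> \<omega>"
        using p l by (simp add: light_steps_def)
      then show ?thesis
        using sub l by (blast intro: light_reach_closed)
    next
      case False
      \<comment> \<open>The heavy last edge costs more than \<delta>, so \<open>k\<close> is
        positive and the rest of the path fits the budget of \<open>k - 1\<close> heavy
        edges.\<close>
      have "0 \<le> passage_time \<omega> p"
        by (rule passage_time_nonneg[OF nonneg p(1)])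
      then have "0 < k"
        using False T \<open>\<delta> > 0\<close> by (intro Nat.gr0I) auto
      then obtain j where j: "k = Suc j" by (cases k) auto
      have "passage_time \<omega> p \<le> real j * \<delta>"
        using T False by (simp add: j algebra_simps)
      then have "?l \<in> light_reach d \<delta> \<omega> j"
        using snoc.IH[OF p(1)] l by blast
      then show ?thesis
        unfolding j using p by (intro light_reach_Suc)
    qed
    then show ?thesis using sub by simp
  qed
qed

text \<open>Only paths within a budget \<open>real k * \<delta>\<close> that admits some path
  \<open>q\<close> compete for the minimum. They are finitely many, being repetition-free lists over
  the finite set \<open>light_reach d \<delta> \<omega> k\<close>.\<close>

lemma ex_geodesic:
  assumes nonneg: "\<And>e. e \<in> edges d \<Longrightarrow> 0 \<le> \<omega> e" and "\<delta> > 0"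
    and fin: "\<And>v. v \<in> verts d \<Longrightarrow> finite ((light_steps d \<delta> \<omega>)\<^sup>* `` {v})"
    and "x \<in> verts d"
  shows "\<exists>p. geodesic d \<omega> x p"
proof -
  obtain q where q: "sa_path d q (origin d) x"
    using ex_sa_path[OF \<open>x \<in> verts d\<close>] by blast
  obtain k :: nat where k: "passage_time \<omega> q / \<delta> \<le> real k"
    using real_arch_simple by blast
  define P where "P = {p. sa_path d p (origin d) x \<and> passage_time \<omega> p \<le> real k * \<delta>}"
  have "P \<subseteq> {p. set p \<subseteq> light_reach d \<delta> \<omega> k \<and> distinct p}"
    using sa_path_in_light_reach[of d \<omega> \<delta> _ x k, OF nonneg \<open>\<delta> > 0\<close>]
    by (fastforce simp: P_def sa_path_def)
  then have "finite P"
    by (rule finite_subset) (intro finite_subset_distinct finite_light_reach fin)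
  moreover have "q \<in> P"
    using q k \<open>\<delta> > 0\<close> by (simp add: P_def field_simps)
  ultimately obtain p where p: "p \<in> P" "\<And>p'. p' \<in> P \<Longrightarrow> passage_time \<omega> p \<le> passage_time \<omega> p'"
    using arg_min_if_finite(1)[of P "passage_time \<omega>"] arg_min_least[of P _ "passage_time \<omega>"] by blast
  \<comment> \<open>A path outside \<open>P\<close> exceeds the budget, which \<open>p\<close>
    respects.\<close>
  have "passage_time \<omega> p \<le> passage_time \<omega> p'" if "sa_path d p' (origin d) x" for p'
    using p(2)[of p'] p(1) that by (cases "p' \<in> P") (auto simp: P_def)
  then show ?thesis
    using p(1) by (auto simp: geodesic_def P_def)
qed

subsection \<open>First geodesics\<close>

lemma first_geodesic_geodesic: "geodesic d \<omega> x p \<Longrightarrow> geodesic d \<omega> x (first_geodesic d ord \<omega> x)"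
  unfolding first_geodesic_def by (rule arg_min_natI)

lemma first_geodesic_le: "geodesic d \<omega> x p \<Longrightarrow> ord (first_geodesic d ord \<omega> x) \<le> ord p"
  unfolding first_geodesic_def by (rule arg_min_nat_le)

text \<open>Lowering the weight of an edge of the first geodesic lowers all paths through that edge by
  the same amount and leaves the others alone, so the new geodesics are the old ones through it.\<close>

lemma first_geodesic_lower:
  assumes "inj ord" and "s \<le> t"
    and g: "geodesic d (X(e := t)) x (first_geodesic d ord (X(e := t)) x)"
    and e: "e \<in> set (path_edges (first_geodesic d ord (X(e := t)) x))"
  shows "first_geodesic d ord (X(e := s)) x = first_geodesic d ord (X(e := t)) x"
    and "geodesic d (X(e := s)) x (first_geodesic d ord (X(e := t)) x)"
proof -
  let ?\<pi> = "first_geodesic d ord (X(e := t)) x"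
  let ?\<rho> = "first_geodesic d ord (X(e := s)) x"
  \<comment> \<open>A self-avoiding path uses \<open>e\<close> at most once, so its passage time
    drops by 0 or by exactly \<open>t - s\<close>.\<close>
  have T: "passage_time (X(e := s)) p =
      passage_time (X(e := t)) p - (if e \<in> set (path_edges p) then t - s else 0)"
    if "sa_path d p (origin d) x" for p
  proof -
    have "distinct p" using that by (simp add: sa_path_def)
    have "(\<Sum>f\<in>set (path_edges p) - {e}. (X(e := s)) f) =
        (\<Sum>f\<in>set (path_edges p) - {e}. (X(e := t)) f)"
      by (intro sum.cong) auto
    then show ?thesis
      using \<open>distinct p\<close> by (auto simp: passage_time_eq_sum sum.remove[of _ e] intro!: sum.cong)
  qed
  have sa: "sa_path d ?\<pi> (origin d) x" using g by (simp add: geodesic_def)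
  show new: "geodesic d (X(e := s)) x ?\<pi>"
    unfolding geodesic_def
  proof (intro conjI allI impI sa)
    fix q assume q: "sa_path d q (origin d) x"
    then have "passage_time (X(e := t)) ?\<pi> \<le> passage_time (X(e := t)) q"
      using g by (simp add: geodesic_def)
    then show "passage_time (X(e := s)) ?\<pi> \<le> passage_time (X(e := s)) q"
      using T[OF q] T[OF sa] e \<open>s \<le> t\<close> by auto
  qed
  show "?\<rho> = ?\<pi>"
  proof (cases "s = t")
    case False
    have \<rho>: "geodesic d (X(e := s)) x ?\<rho>"
      by (rule first_geodesic_geodesic[OF new])
    then have sa': "sa_path d ?\<rho> (origin d) x" by (simp add: geodesic_def)
    have le: "passage_time (X(e := s)) ?\<rho> \<le> passage_time (X(e := s)) ?\<pi>"
      using \<rho> sa by (simp add: geodesic_def)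
    have le': "passage_time (X(e := t)) ?\<pi> \<le> passage_time (X(e := t)) q"
      if "sa_path d q (origin d) x" for q
      using g that by (simp add: geodesic_def)
    \<comment> \<open>If \<open>?\<rho>\<close> avoided \<open>e\<close>, it would be strictly
      faster than \<open>?\<pi>\<close> at weight \<open>t\<close>, as \<open>s < t\<close>. So both
      paths contain \<open>e\<close> and lose the same amount.\<close>
    have "passage_time (X(e := t)) ?\<rho> \<le> passage_time (X(e := t)) ?\<pi>"
      using le T[OF sa] T[OF sa'] e False \<open>s \<le> t\<close> le'[OF sa'] by (auto split: if_splits)
    then have "geodesic d (X(e := t)) x ?\<rho>"
      using sa' le' by (fastforce simp: geodesic_def)
    \<comment> \<open>Each path is a geodesic in the configuration where the other comes first, so
      they have equal rank.\<close>
    then have "ord ?\<pi> \<le> ord ?\<rho>" by (rule first_geodesic_le)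
    moreover have "ord ?\<rho> \<le> ord ?\<pi>" by (rule first_geodesic_le[OF new])
    ultimately show ?thesis
      using \<open>inj ord\<close> by (simp add: inj_eq)
  qed simp
qed

subsection \<open>Subcritical percolation\<close>

text \<open>Both measures agree on cylinders, where they are finite products. This transfers almost
  sure statements when every edge variable is transformed separately, by thinning or by
  thresholding.\<close>

lemma distr_PiM_map:
  assumes M: "prob_space M" and f[measurable]: "f \<in> M \<rightarrow>\<^sub>M N"
  shows "distr (PiM I (\<lambda>_. M)) (PiM I (\<lambda>_. N)) (\<lambda>\<omega>. \<lambda>i\<in>I. f (\<omega> i)) = PiM I (\<lambda>_. distr M N f)"
proof (rule measure_eqI_PiM_infinite[symmetric])
  have D: "prob_space (distr M N f)"
    using M f by (rule prob_space.prob_space_distr)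
  interpret P: prob_space "PiM I (\<lambda>_. distr M N f)"
    by (intro prob_space_PiM D)
  show "finite_measure (PiM I (\<lambda>_. distr M N f))" by unfold_locales
  show "sets (PiM I (\<lambda>_. distr M N f)) = sets (PiM I (\<lambda>_. N))"
    by (intro sets_PiM_cong) auto
  fix A J assume J: "finite J" "J \<subseteq> I" and A: "\<And>i. i \<in> J \<Longrightarrow> A i \<in> sets N"
  have emb: "prod_emb I (\<lambda>_. distr M N f) J (Pi\<^sub>E J A) = prod_emb I (\<lambda>_. N) J (Pi\<^sub>E J A)"
    by (simp add: prod_emb_def)
  have "(\<lambda>\<omega>. \<lambda>i\<in>I. f (\<omega> i)) -` prod_emb I (\<lambda>_. N) J (Pi\<^sub>E J A) \<inter> space (PiM I (\<lambda>_. M)) =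
      prod_emb I (\<lambda>_. M) J (\<Pi>\<^sub>E i\<in>J. f -` A i \<inter> space M)"
    using J measurable_space[OF f]
    by (auto simp: prod_emb_def space_PiM PiE_iff Pi_iff subset_iff)
  then have "distr (PiM I (\<lambda>_. M)) (PiM I (\<lambda>_. N)) (\<lambda>\<omega>. \<lambda>i\<in>I. f (\<omega> i))
      (prod_emb I (\<lambda>_. N) J (Pi\<^sub>E J A)) =
      PiM I (\<lambda>_. M) (prod_emb I (\<lambda>_. M) J (\<Pi>\<^sub>E i\<in>J. f -` A i \<inter> space M))"
    using J A by (subst emeasure_distr) (auto intro!: sets_PiM_I)
  also have "\<dots> = (\<Prod>i\<in>J. M (f -` A i \<inter> space M))"
    using J A M f by (intro emeasure_PiM_emb) (auto intro: measurable_sets)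
  also have "\<dots> = (\<Prod>i\<in>J. distr M N f (A i))"
    using A f by (intro prod.cong) (auto simp: emeasure_distr)
  also have "\<dots> = PiM I (\<lambda>_. distr M N f) (prod_emb I (\<lambda>_. distr M N f) J (Pi\<^sub>E J A))"
    using J A D by (intro emeasure_PiM_emb[symmetric]) auto
  finally show "PiM I (\<lambda>_. distr M N f) (prod_emb I (\<lambda>_. N) J (Pi\<^sub>E J A)) =
      distr (PiM I (\<lambda>_. M)) (PiM I (\<lambda>_. N)) (\<lambda>\<omega>. \<lambda>i\<in>I. f (\<omega> i))
        (prod_emb I (\<lambda>_. N) J (Pi\<^sub>E J A))"
    by (simp add: emb)
qed auto

section \<open>Finiteness of the open cluster and its dependence on the parameter\<close>

definition open_steps :: "nat \<Rightarrow> (int list set \<Rightarrow> bool) \<Rightarrow> (int list \<times> int list) set" where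
  "open_steps d \<omega> = {(x, z). x \<in> verts d \<and> z \<in> verts d \<and> adj x z \<and> \<omega> {x, z}}"

lemma open_cluster_altdef: "open_cluster d \<omega> = (open_steps d \<omega>)\<^sup>* `` {origin d}"
  by (auto simp: open_cluster_def open_steps_def)

lemma open_cluster_mono:
  assumes "\<And>e. e \<in> edges d \<Longrightarrow> \<omega> e \<Longrightarrow> \<omega>' e"
  shows "open_cluster d \<omega> \<subseteq> open_cluster d \<omega>'"
proof -
  have "open_steps d \<omega> \<subseteq> open_steps d \<omega>'"
    using assms by (auto simp: open_steps_def intro: edgeI)
  then show ?thesis
    unfolding open_cluster_altdef by (intro Image_mono rtrancl_mono subset_refl)
qed

text \<open>Vertices form a countable type, so reachability is a countable union over path lengths
  and intermediate points. Stated over count spaces, the result serves every bond parameter at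
  once.\<close>

lemma pred_finite_open_cluster:
  "Measurable.pred (PiM (edges d) (\<lambda>_. count_space UNIV)) (\<lambda>\<omega>. finite (open_cluster d \<omega>))"
proof -
  let ?M = "PiM (edges d) (\<lambda>_. count_space (UNIV :: bool set))"
  have step: "Measurable.pred ?M (\<lambda>\<omega>. (x, y) \<in> open_steps d \<omega>)" for x y
  proof (cases "x \<in> verts d \<and> y \<in> verts d \<and> adj x y")
    case True
    then have "Measurable.pred ?M (\<lambda>\<omega>. \<omega> {x, y})"
      by (intro measurable_component_singleton edgeI) auto
    with True show ?thesis by (simp add: open_steps_def)
  qed (auto simp: open_steps_def)
  have pow: "Measurable.pred ?M (\<lambda>\<omega>. (origin d, y) \<in> open_steps d \<omega> ^^ n)" for n y
  proof (induction n arbitrary: y)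
    case (Suc n)
    have "(\<lambda>\<omega>. (origin d, y) \<in> open_steps d \<omega> ^^ Suc n) =
        (\<lambda>\<omega>. \<exists>z. (origin d, z) \<in> open_steps d \<omega> ^^ n \<and> (z, y) \<in> open_steps d \<omega>)"
      by (auto simp: relcomp_unfold)
    then show ?case
      using Suc step by (auto intro!: pred_intros_countable pred_intros_logic)
  qed simp
  \<comment> \<open>Lists stand in for finite sets, which makes the existential quantifier
    countable.\<close>
  have "finite (open_cluster d \<omega>) \<longleftrightarrow>
      (\<exists>l. \<forall>y. (\<exists>n. (origin d, y) \<in> open_steps d \<omega> ^^ n) \<longrightarrow> y \<in> set l)" for \<omega>
  proof
    assume "finite (open_cluster d \<omega>)"
    then obtain l where "set l = open_cluster d \<omega>"
      using finite_list by blast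
    then show "\<exists>l. \<forall>y. (\<exists>n. (origin d, y) \<in> open_steps d \<omega> ^^ n) \<longrightarrow> y \<in> set l"
      by (intro exI[of _ l]) (auto simp: open_cluster_altdef rtrancl_power)
  next
    assume "\<exists>l. \<forall>y. (\<exists>n. (origin d, y) \<in> open_steps d \<omega> ^^ n) \<longrightarrow> y \<in> set l"
    then obtain l where "\<forall>y. (\<exists>n. (origin d, y) \<in> open_steps d \<omega> ^^ n) \<longrightarrow> y \<in> set l" ..
    then have "open_cluster d \<omega> \<subseteq> set l"
      by (auto simp: open_cluster_altdef rtrancl_power)
    then show "finite (open_cluster d \<omega>)"
      by (rule finite_subset) simp
  qed
  then show ?thesis
    by (simp only:) (intro pred_intros_countable pred_intros_logic pow measurable_const; simp)
qed

lemma sets_bond_measure: "sets (bond_measure d p) = sets (PiM (edges d) (\<lambda>_. count_space UNIV))"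
  unfolding bond_measure_def by (intro sets_PiM_cong) auto

lemma prob_space_bond_measure: "prob_space (bond_measure d p)"
  unfolding bond_measure_def by (intro prob_space_PiM measure_pmf.prob_space_axioms)

lemma pred_finite_open_cluster_bond:
  "Measurable.pred (bond_measure d p) (\<lambda>\<omega>. finite (open_cluster d \<omega>))"
  using pred_finite_open_cluster measurable_cong_sets[OF sets_bond_measure refl] by blast

lemma theta_eq_0_iff: "theta d p = 0 \<longleftrightarrow> (AE \<omega> in bond_measure d p. finite (open_cluster d \<omega>))"
proof -
  interpret prob_space "bond_measure d p" by (rule prob_space_bond_measure)
  note pred_finite_open_cluster_bond[measurable]
  show ?thesis
    unfolding theta_def by (subst prob_eq_0) auto
qed

text \<open>Almost surely all of the countably many edges are closed. This makes the set in
  \<open>p_c\<close> nonempty and covers thresholds below the essential infimum.\<close>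

lemma theta_0: "theta d 0 = 0"
  unfolding theta_eq_0_iff
proof -
  have "AE \<omega> in bond_measure d 0. \<not> \<omega> e" if "e \<in> edges d" for e
    unfolding bond_measure_def using that
    by (intro AE_PiM_component[where P = Not] measure_pmf.prob_space_axioms)
       (auto simp: AE_measure_pmf_iff set_pmf_iff)
  then have "AE \<omega> in bond_measure d 0. \<forall>e\<in>edges d. \<not> \<omega> e"
    by (simp add: AE_ball_countable countable_edges)
  then show "AE \<omega> in bond_measure d 0. finite (open_cluster d \<omega>)"
  proof eventually_elim
    case (elim \<omega>)
    then have "open_steps d \<omega> = {}"
      by (auto simp: open_steps_def dest: edgeI)
    then show ?case by (simp add: open_cluster_altdef)
  qed
qed

lemma map_pmf_conj_bernoulli:
  assumes "p \<in> {0..1}" "q \<in> {0..1}"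
  shows "map_pmf (\<lambda>(a, b). a \<and> b) (pair_pmf (bernoulli_pmf p) (bernoulli_pmf q)) = bernoulli_pmf (p * q)"
proof (rule pmf_eqI)
  let ?K = "pair_pmf (bernoulli_pmf p) (bernoulli_pmf q)"
  have "(\<lambda>(a, b). a \<and> b) -` {True} = {(True, True)}" by auto
  then have T: "pmf (map_pmf (\<lambda>(a, b). a \<and> b) ?K) True = p * q"
    using assms by (simp add: pmf_map measure_pmf_single pmf_pair)
  have "0 \<le> p * q" "p * q \<le> 1"
    using assms by (auto intro: mult_le_one)
  then show "pmf (map_pmf (\<lambda>(a, b). a \<and> b) ?K) b = pmf (bernoulli_pmf (p * q)) b" for b
    using T by (cases b) (simp_all add: pmf_False_conv_True)
qed

text \<open>Coupling by thinning: keep each edge that is open at parameter \<open>p\<close>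
  according to an independent coin of bias \<open>q / p\<close>. This yields parameter
  \<open>q\<close>, with a cluster inside the original one.\<close>

lemma theta_eq_0_mono:
  assumes "theta d p = 0" "0 \<le> q" "q \<le> p" "p \<le> 1"
  shows "theta d q = 0"
proof (cases "p = 0")
  case True
  then show ?thesis using assms by simp
next
  case False
  define K where "K = pair_pmf (bernoulli_pmf p) (bernoulli_pmf (q / p))"
  have fst: "distr K (count_space UNIV) fst = bernoulli_pmf p"
    unfolding map_pmf_rep_eq[symmetric] K_def by (simp add: map_fst_pair_pmf)
  have conj: "distr K (count_space UNIV) (\<lambda>(a, b). a \<and> b) = bernoulli_pmf q"
    unfolding map_pmf_rep_eq[symmetric] K_def
    using assms False by (subst map_pmf_conj_bernoulli) auto
  let ?P = "PiM (edges d) (\<lambda>_. measure_pmf K)" and ?N = "PiM (edges d) (\<lambda>_. count_space (UNIV :: bool set))"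
  have D: "distr ?P ?N (\<lambda>\<omega>. \<lambda>e\<in>edges d. fst (\<omega> e)) = bond_measure d p"
    "distr ?P ?N (\<lambda>\<omega>. \<lambda>e\<in>edges d. (\<lambda>(a, b). a \<and> b) (\<omega> e)) = bond_measure d q"
    unfolding bond_measure_def fst[symmetric] conj[symmetric]
    by (rule distr_PiM_map; simp add: measure_pmf.prob_space_axioms)+
  have m: "(\<lambda>\<omega>. \<lambda>e\<in>edges d. f (\<omega> e)) \<in> ?P \<rightarrow>\<^sub>M ?N" for f :: "bool \<times> bool \<Rightarrow> bool"
    by measurable
  have "AE \<omega> in ?P. finite (open_cluster d (\<lambda>e\<in>edges d. fst (\<omega> e)))"
    using assms(1) unfolding theta_eq_0_iff D(1)[symmetric] by (rule AE_distrD[OF m])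
  then have "AE \<omega> in ?P. finite (open_cluster d (\<lambda>e\<in>edges d. (\<lambda>(a, b). a \<and> b) (\<omega> e)))"
    by eventually_elim (erule finite_subset[rotated], auto intro!: open_cluster_mono)
  then show ?thesis
    unfolding theta_eq_0_iff D(2)[symmetric]
    using pred_finite_open_cluster by (subst AE_distr_iff[OF m]) auto
qed

section \<open>Translations, and light clusters of arbitrary vertices\<close>

definition translate :: "int list \<Rightarrow> int list \<Rightarrow> int list" where
  "translate v x = map2 (+) v x"

lemma translate_in_verts: "v \<in> verts d \<Longrightarrow> x \<in> verts d \<Longrightarrow> translate v x \<in> verts d"
  by (simp add: translate_def verts_length)

lemma adj_translate_iff:
  assumes "v \<in> verts d" "x \<in> verts d" "y \<in> verts d"
  shows "adj (translate v x) (translate v y) \<longleftrightarrow> adj x y"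
proof -
  have "map2 (-) (translate v x) (translate v y) = map2 (-) x y"
    using assms by (intro nth_equalityI) (auto simp: translate_def verts_length)
  then show ?thesis
    using assms by (simp add: adj_def) (simp add: translate_def verts_length)
qed

lemma inj_on_translate: "v \<in> verts d \<Longrightarrow> inj_on (translate v) (verts d)"
  by (intro inj_onI) (auto simp: translate_def verts_length list_eq_iff_nth_eq)

lemma translate_surj:
  assumes "v \<in> verts d" "y \<in> verts d"
  obtains x where "x \<in> verts d" "y = translate v x"
proof
  show "map2 (-) y v \<in> verts d"
    using assms by (simp add: verts_length)
  show "y = translate v (map2 (-) y v)"
    using assms by (intro nth_equalityI) (auto simp: translate_def verts_length)
qed

lemma translate_edges: "v \<in> verts d \<Longrightarrow> e \<in> edges d \<Longrightarrow> translate v ` e \<in> edges d"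
  by (auto simp: edges_def translate_in_verts adj_translate_iff) (metis translate_in_verts adj_translate_iff)

lemma inj_on_translate_edges:
  assumes "v \<in> verts d"
  shows "inj_on ((`) (translate v)) (edges d)"
proof -
  have "edges d \<subseteq> Pow (verts d)" by (auto simp: edges_def)
  then show ?thesis
    using inj_on_image_Pow[OF inj_on_translate[OF assms]] inj_on_subset by blast
qed

text \<open>\<open>theta\<close> speaks of the cluster of the origin only. Shifting the
  configuration moves the cluster of \<open>v\<close> there, and this inclusion is enough to
  transfer finiteness.\<close>

lemma light_cluster_translate:
  assumes v: "v \<in> verts d"
  shows "(light_steps d \<delta> \<omega>)\<^sup>* `` {v} \<subseteq>
    translate v ` open_cluster d (\<lambda>e\<in>edges d. \<omega> (translate v ` e) \<le> \<delta>)"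
proof -
  let ?b = "\<lambda>e\<in>edges d. \<omega> (translate v ` e) \<le> \<delta>"
  have "\<exists>y0. y0 \<in> verts d \<and> y = translate v y0 \<and> (origin d, y0) \<in> (open_steps d ?b)\<^sup>*"
    if "(v, y) \<in> (light_steps d \<delta> \<omega>)\<^sup>*" for y
    using that
  proof (induction rule: rtrancl_induct)
    case base
    have "v = translate v (origin d)"
      using v by (intro nth_equalityI) (auto simp: translate_def origin_def verts_length)
    then show ?case using origin_in_verts by blast
  next
    case (step y z)
    then obtain y0 where y0: "y0 \<in> verts d" "y = translate v y0" "(origin d, y0) \<in> (open_steps d ?b)\<^sup>*"
      by blast
    have z: "z \<in> verts d" "adj y z" "\<omega> {y, z} \<le> \<delta>"
      using step by (auto simp: light_steps_def)
    obtain z0 where z0: "z0 \<in> verts d" "z = translate v z0"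
      using translate_surj[OF v z(1)] by blast
    have "adj y0 z0"
      using z y0 z0 v by (simp add: adj_translate_iff)
    then have "(y0, z0) \<in> open_steps d ?b"
      using y0 z0 z edgeI by (auto simp: open_steps_def)
    then show ?case
      using y0(3) z0 by (blast intro: rtrancl_into_rtrancl)
  qed
  then show ?thesis
    by (auto simp: open_cluster_altdef)
qed

lemma prob_space_fpp_measure: "prob_space \<mu> \<Longrightarrow> prob_space (fpp_measure d \<mu>)"
  unfolding fpp_measure_def by (intro prob_space_PiM)

lemma distr_threshold_bernoulli:
  assumes "prob_space \<mu>" and sets: "sets \<mu> = sets borel"
  shows "distr \<mu> (count_space UNIV) (\<lambda>t. t \<le> \<delta>) = measure_pmf (bernoulli_pmf (distrF \<mu> \<delta>))"
proof -
  interpret prob_space \<mu> by fact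
  have space: "space \<mu> = UNIV"
    using sets_eq_imp_space_eq[OF sets] by simp
  have m: "(\<lambda>t. t \<le> \<delta>) \<in> \<mu> \<rightarrow>\<^sub>M count_space UNIV"
    by (subst measurable_cong_sets[OF sets refl]) measurable
  have F: "0 \<le> distrF \<mu> \<delta>" "distrF \<mu> \<delta> \<le> 1"
    by (auto simp: distrF_def)
  have "prob {\<delta><..} = 1 - distrF \<mu> \<delta>"
    using prob_compl[of "{..\<delta>}"] sets space
    by (simp add: distrF_def Compl_eq_Diff_UNIV[symmetric])
  moreover have "(\<lambda>t. t \<le> \<delta>) -` {True} = {..\<delta>}" "(\<lambda>t. t \<le> \<delta>) -` {False} = {\<delta><..}"
    unfolding vimage_def by (simp_all add: not_le atMost_def greaterThan_def)
  ultimately have "prob ((\<lambda>t. t \<le> \<delta>) -` {b} \<inter> space \<mu>) = pmf (bernoulli_pmf (distrF \<mu> \<delta>)) b" for b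
    using F by (cases b) (simp_all only: space Int_UNIV_right pmf_bernoulli_True pmf_bernoulli_False,
      simp add: distrF_def)
  then have "emeasure (distr \<mu> (count_space UNIV) (\<lambda>t. t \<le> \<delta>)) {b} =
      emeasure (bernoulli_pmf (distrF \<mu> \<delta>)) {b}" for b
    by (subst emeasure_distr[OF m]) (simp_all add: emeasure_eq_measure emeasure_pmf_single)
  then show ?thesis
    by (intro measure_eqI_countable[where A = UNIV]) auto
qed

text \<open>Shifting by \<open>v\<close> preserves the law of the weights, and thresholding then
  gives Bernoulli percolation with parameter \<open>distrF \<mu> \<delta>\<close>. So each cluster
  is almost surely finite, and there are countably many vertices.\<close>

lemma AE_finite_light_clusters:
  assumes \<mu>: "prob_space \<mu>" and sets: "sets \<mu> = sets borel"
    and theta: "theta d (distrF \<mu> \<delta>) = 0"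
  shows "AE \<omega> in fpp_measure d \<mu>. \<forall>v\<in>verts d. finite ((light_steps d \<delta> \<omega>)\<^sup>* `` {v})"
proof -
  have "AE \<omega> in fpp_measure d \<mu>. finite ((light_steps d \<delta> \<omega>)\<^sup>* `` {v})" if v: "v \<in> verts d" for v
  proof -
    let ?I = "edges d" and ?N = "count_space (UNIV :: bool set)"
    let ?P = "PiM ?I (\<lambda>_. \<mu>)"
    have thr: "(\<lambda>t. t \<le> \<delta>) \<in> \<mu> \<rightarrow>\<^sub>M ?N"
      by (subst measurable_cong_sets[OF sets refl]) measurable
    have sh: "(\<lambda>\<omega>. \<lambda>e\<in>?I. \<omega> (translate v ` e)) \<in> ?P \<rightarrow>\<^sub>M ?P"
      by (intro measurable_restrict measurable_component_singleton translate_edges v)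
    have th: "(\<lambda>\<omega>. \<lambda>e\<in>?I. \<omega> e \<le> \<delta>) \<in> ?P \<rightarrow>\<^sub>M PiM ?I (\<lambda>_. ?N)"
      by (intro measurable_restrict measurable_compose[OF _ thr] measurable_component_singleton)
    have "distr ?P ?P (\<lambda>\<omega>. \<lambda>e\<in>?I. \<omega> (translate v ` e)) = ?P"
      by (rule distr_PiM_reindex[of ?I "\<lambda>_. \<mu>"]) (auto intro: \<mu> inj_on_translate_edges v translate_edges)
    moreover have "distr ?P (PiM ?I (\<lambda>_. ?N)) (\<lambda>\<omega>. \<lambda>e\<in>?I. \<omega> e \<le> \<delta>) = bond_measure d (distrF \<mu> \<delta>)"
      unfolding bond_measure_def distr_threshold_bernoulli[OF \<mu> sets, symmetric]
      by (rule distr_PiM_map[OF \<mu> thr])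
    ultimately have D: "bond_measure d (distrF \<mu> \<delta>) =
        distr ?P (PiM ?I (\<lambda>_. ?N)) ((\<lambda>\<omega>. \<lambda>e\<in>?I. \<omega> e \<le> \<delta>) \<circ> (\<lambda>\<omega>. \<lambda>e\<in>?I. \<omega> (translate v ` e)))"
      using distr_distr[OF th sh] by simp
    have "AE \<omega> in ?P. finite (open_cluster d (((\<lambda>\<omega>. \<lambda>e\<in>?I. \<omega> e \<le> \<delta>) \<circ> (\<lambda>\<omega>. \<lambda>e\<in>?I. \<omega> (translate v ` e))) \<omega>))"
      using theta unfolding theta_eq_0_iff D by (rule AE_distrD[OF measurable_comp[OF sh th]])
    then show ?thesis
      unfolding fpp_measure_def
    proof eventually_elim
      case (elim \<omega>)
      have "((\<lambda>\<omega>. \<lambda>e\<in>?I. \<omega> e \<le> \<delta>) \<circ> (\<lambda>\<omega>. \<lambda>e\<in>?I. \<omega> (translate v ` e))) \<omega> =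
          (\<lambda>e\<in>?I. \<omega> (translate v ` e) \<le> \<delta>)"
        by (auto simp: fun_eq_iff)
      then show ?case
        using elim finite_subset[OF light_cluster_translate[OF v]] by simp
    qed
  qed
  then show ?thesis
    by (subst AE_ball_countable) auto
qed

subsection \<open>Almost sure existence of geodesics\<close>

lemma real_distributionI:
  "prob_space \<mu> \<Longrightarrow> sets \<mu> = sets borel \<Longrightarrow> real_distribution \<mu>"
  by (auto simp: real_distribution_def real_distribution_axioms_def dest: sets_eq_imp_space_eq)

lemma distrF_eq_cdf: "distrF \<mu> = cdf \<mu>"
  by (auto simp: distrF_def cdf_def)

text \<open>A real \<open>Inf\<close> is informative only for a nonempty set bounded below. The
  first holds as the distribution function tends to 1, the second as negative numbers carry no
  mass.\<close>

lemma ess_inf_r_lower: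
  assumes "prob_space \<mu>" and sets: "sets \<mu> = sets borel" and neg: "measure \<mu> {..<0} = 0"
  shows "0 \<le> ess_inf_r \<mu>" and "t < ess_inf_r \<mu> \<Longrightarrow> distrF \<mu> t = 0"
proof -
  interpret real_distribution \<mu>
    using assms by (intro real_distributionI)
  have low: "0 \<le> t" if "0 < distrF \<mu> t" for t
  proof (rule ccontr)
    assume "\<not> 0 \<le> t"
    then have "distrF \<mu> t \<le> measure \<mu> {..<0}"
      unfolding distrF_def by (intro finite_measure_mono) auto
    then show False using that neg by simp
  qed
  have "eventually (\<lambda>t. 0 < cdf \<mu> t) at_top"
    using cdf_lim_at_top_prob by (rule order_tendstoD) simp
  then obtain t where "0 < distrF \<mu> t"
    unfolding distrF_eq_cdf using eventually_happens'[OF trivial_limit_at_top_linorder] by blast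
  then show "0 \<le> ess_inf_r \<mu>"
    unfolding ess_inf_r_def by (intro cInf_greatest) (auto intro: low)
  show "distrF \<mu> t = 0" if "t < ess_inf_r \<mu>" for t
  proof (rule ccontr)
    assume "distrF \<mu> t \<noteq> 0"
    then have "0 < distrF \<mu> t"
      by (simp add: distrF_def zero_less_measure_iff)
    then have "ess_inf_r \<mu> \<le> t"
      unfolding ess_inf_r_def by (intro cInf_lower) (auto intro!: bdd_belowI[of _ 0] low)
    then show False using that by simp
  qed
qed

text \<open>The open half-line below the essential infimum is exhausted by countably many closed
  ones, each null because \<open>distrF\<close> vanishes at its endpoint.\<close>

lemma AE_ess_inf_r_le:
  assumes "prob_space \<mu>" and sets: "sets \<mu> = sets borel" and "measure \<mu> {..<0} = 0"
  shows "AE t in \<mu>. ess_inf_r \<mu> \<le> t"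
proof -
  interpret real_distribution \<mu>
    using assms by (intro real_distributionI)
  let ?r = "ess_inf_r \<mu>"
  have "AE t in \<mu>. ?r - 1 / real (Suc n) < t" for n
  proof -
    have "measure \<mu> {..?r - 1 / real (Suc n)} = 0"
      using ess_inf_r_lower(2)[OF assms, of "?r - 1 / real (Suc n)"] by (simp add: distrF_def)
    then have "{..?r - 1 / real (Suc n)} \<in> null_sets \<mu>"
      by (auto simp: null_sets_def emeasure_eq_measure)
    then have "AE t in \<mu>. t \<notin> {..?r - 1 / real (Suc n)}"
      by (rule AE_not_in)
    then show ?thesis by eventually_elim auto
  qed
  then have "AE t in \<mu>. \<forall>n. ?r - 1 / real (Suc n) < t"
    by (simp add: AE_all_countable)
  then show ?thesis
  proof eventually_elim
    case (elim t)
    show ?case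
    proof (rule ccontr)
      assume "\<not> ?r \<le> t"
      then obtain n where "inverse (real (Suc n)) < ?r - t"
        using reals_Archimedean[of "?r - t"] by auto
      then show False using elim[rule_format, of n] by (simp add: inverse_eq_divide)
    qed
  qed
qed

text \<open>If the essential infimum is 0, some \<open>p\<close> in the set defining
  \<open>p_c\<close> exceeds \<open>distrF \<mu> 0\<close>, and right continuity keeps
  \<open>distrF \<mu>\<close> below \<open>p\<close> slightly to the right of 0. If it is positive,
  \<open>distrF \<mu>\<close> vanishes at half of it.\<close>

lemma ex_subcritical_threshold:
  assumes "prob_space \<mu>" "sets \<mu> = sets borel" "measure \<mu> {..<0} = 0"
    and "ess_inf_r \<mu> = 0 \<Longrightarrow> distrF \<mu> (ess_inf_r \<mu>) < p_c d"
  shows "\<exists>\<delta>>0. theta d (distrF \<mu> \<delta>) = 0"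
proof (cases "ess_inf_r \<mu> = 0")
  case True
  interpret real_distribution \<mu>
    using assms by (intro real_distributionI)
  have "distrF \<mu> 0 < Sup {p \<in> {0..1}. theta d p = 0}"
    using assms(4)[OF True] by (simp add: True p_c_def)
  moreover have "{p \<in> {0..1}. theta d p = 0} \<noteq> {}"
    using theta_0[of d] by (auto intro!: exI[of _ 0])
  moreover have "bdd_above {p \<in> {0..1}. theta d p = 0}"
    by (intro bdd_aboveI[of _ 1]) auto
  ultimately obtain p where p: "0 \<le> p" "p \<le> 1" "theta d p = 0" "distrF \<mu> 0 < p"
    by (auto simp: less_cSup_iff)
  have "(cdf \<mu> \<longlongrightarrow> cdf \<mu> 0) (at_right 0)"
    using cdf_is_right_cont[of 0] by (simp add: continuous_within)
  then have "eventually (\<lambda>\<delta>. distrF \<mu> \<delta> < p) (at_right 0)"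
    using p(4) unfolding distrF_eq_cdf by (rule order_tendstoD)
  moreover have "eventually (\<lambda>\<delta>::real. 0 < \<delta>) (at_right 0)"
    by (rule eventually_at_right_less)
  ultimately have "eventually (\<lambda>\<delta>. distrF \<mu> \<delta> < p \<and> 0 < \<delta>) (at_right 0)"
    by eventually_elim simp
  then obtain \<delta> where "distrF \<mu> \<delta> < p" "0 < \<delta>"
    using eventually_happens' [OF trivial_limit_at_right_real] by blast
  then show ?thesis
    using theta_eq_0_mono[OF p(3), of "distrF \<mu> \<delta>"] p(2) by (auto simp: distrF_def)
next
  case False
  then have "0 < ess_inf_r \<mu>"
    using ess_inf_r_lower(1)[OF assms(1-3)] by simp
  then show ?thesis
    using ess_inf_r_lower(2)[OF assms(1-3), of "ess_inf_r \<mu> / 2"]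
    by (intro exI[of _ "ess_inf_r \<mu> / 2"]) (simp add: theta_0)
qed

lemma AE_ex_geodesic:
  assumes \<mu>: "prob_space \<mu>" "sets \<mu> = sets borel" "measure \<mu> {..<0} = 0"
    and "ess_inf_r \<mu> = 0 \<Longrightarrow> distrF \<mu> (ess_inf_r \<mu>) < p_c d"
    and "x \<in> verts d"
  shows "AE \<omega> in fpp_measure d \<mu>. \<exists>p. geodesic d \<omega> x p"
proof -
  obtain \<delta> where \<delta>: "\<delta> > 0" "theta d (distrF \<mu> \<delta>) = 0"
    using ex_subcritical_threshold[OF assms(1-4)] by blast
  have "AE t in \<mu>. 0 \<le> t"
    using AE_ess_inf_r_le[OF \<mu>] by eventually_elim (use ess_inf_r_lower(1)[OF \<mu>] in simp)
  then have "AE \<omega> in fpp_measure d \<mu>. 0 \<le> \<omega> e" if "e \<in> edges d" for e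
    unfolding fpp_measure_def using that \<mu>(1) by (intro AE_PiM_component)
  then have "AE \<omega> in fpp_measure d \<mu>. \<forall>e\<in>edges d. 0 \<le> \<omega> e"
    by (simp add: AE_ball_countable countable_edges)
  with AE_finite_light_clusters[OF \<mu>(1,2) \<delta>(2)] show ?thesis
    by eventually_elim (rule ex_geodesic[OF _ \<delta>(1) _ \<open>x \<in> verts d\<close>], auto)
qed

subsection \<open>Measurability\<close>

text \<open>Off \<open>edges d\<close>, points of the product space take the constant value
  \<open>undefined\<close>. Covering this case makes passage times of arbitrary vertex lists
  measurable.\<close>

lemma measurable_fpp_component:
  assumes "sets \<mu> = sets borel"
  shows "(\<lambda>\<omega>. \<omega> e) \<in> borel_measurable (fpp_measure d \<mu>)"
proof (cases "e \<in> edges d")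
  case True
  then have "(\<lambda>\<omega>. \<omega> e) \<in> fpp_measure d \<mu> \<rightarrow>\<^sub>M \<mu>"
    unfolding fpp_measure_def by (rule measurable_component_singleton)
  then show ?thesis
    using measurable_cong_sets[OF refl assms] by blast
next
  case False
  have "(\<lambda>\<omega>. \<omega> e) \<in> borel_measurable (fpp_measure d \<mu>) \<longleftrightarrow>
      (\<lambda>\<omega>. undefined :: real) \<in> borel_measurable (fpp_measure d \<mu>)"
    using False by (intro measurable_cong) (auto simp: fpp_measure_def space_PiM PiE_def extensional_def)
  then show ?thesis by simp
qed

lemma measurable_passage_time:
  assumes "sets \<mu> = sets borel"
  shows "(\<lambda>\<omega>. passage_time \<omega> p) \<in> borel_measurable (fpp_measure d \<mu>)"
proof -
  have "(\<lambda>\<omega>. sum_list (map \<omega> es)) \<in> borel_measurable (fpp_measure d \<mu>)" for es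
    by (induction es) (auto intro!: borel_measurable_add measurable_fpp_component assms)
  then show ?thesis by (simp add: passage_time_def)
qed

lemma pred_geodesic:
  assumes "sets \<mu> = sets borel"
  shows "Measurable.pred (fpp_measure d \<mu>) (\<lambda>\<omega>. geodesic d \<omega> x p)"
proof -
  have [measurable]: "Measurable.pred (fpp_measure d \<mu>) (\<lambda>\<omega>. passage_time \<omega> p \<le> passage_time \<omega> q)" for q
    unfolding pred_def by (intro borel_measurable_le measurable_passage_time assms)
  show ?thesis unfolding geodesic_def by measurable
qed

text \<open>Vertex lists form a countable type, so it suffices to treat each single value
  \<open>p\<close>; being the geodesic of least rank is a countable combination of
  \<open>geodesic\<close> events.\<close>

lemma measurable_first_geodesic:
  assumes sets: "sets \<mu> = sets borel" and "inj ord"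
  shows "(\<lambda>\<omega>. first_geodesic d ord \<omega> x) \<in> fpp_measure d \<mu> \<rightarrow>\<^sub>M count_space UNIV"
proof -
  note pred_geodesic[OF sets, measurable]
  \<comment> \<open>Without a geodesic, \<open>arg_min\<close> returns a fixed junk list.\<close>
  define J where "J = arg_min ord (\<lambda>_. False)"
  have eq: "first_geodesic d ord \<omega> x = p \<longleftrightarrow>
      geodesic d \<omega> x p \<and> (\<forall>q. geodesic d \<omega> x q \<longrightarrow> ord p \<le> ord q) \<or>
      (\<forall>q. \<not> geodesic d \<omega> x q) \<and> p = J" for \<omega> p
  proof (cases "\<exists>q. geodesic d \<omega> x q")
    case True
    then have "geodesic d \<omega> x (first_geodesic d ord \<omega> x)"
      using first_geodesic_geodesic by blast
    moreover have "ord (first_geodesic d ord \<omega> x) \<le> ord q" if "geodesic d \<omega> x q" for q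
      using that by (rule first_geodesic_le)
    ultimately show ?thesis
      using True \<open>inj ord\<close> by (metis antisym injD)
  next
    case False
    then have "geodesic d \<omega> x = (\<lambda>_. False)" by auto
    then show ?thesis by (auto simp: first_geodesic_def J_def)
  qed
  have "Measurable.pred (fpp_measure d \<mu>) (\<lambda>\<omega>. first_geodesic d ord \<omega> x = p)" for p
    unfolding eq by measurable
  then show ?thesis
    by (subst measurable_count_space_eq2_countable) (auto simp: pred_def vimage_def Int_def conj_commute)
qed

lemma measurable_nu:
  assumes sets: "sets \<mu> = sets borel" and "inj ord"
  shows "(\<lambda>\<omega>. nu d ord \<omega> x {a..b}) \<in> borel_measurable (fpp_measure d \<mu>)"
proof -
  note measurable_fpp_component[OF sets, measurable]
  have "(\<lambda>\<omega>. real (length (filter (\<lambda>e. \<omega> e \<in> {a..b}) es))) \<in> borel_measurable (fpp_measure d \<mu>)" for es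
  proof (induction es)
    case (Cons e es)
    have "(\<lambda>\<omega>. real (length (filter (\<lambda>e. \<omega> e \<in> {a..b}) (e # es)))) =
        (\<lambda>\<omega>. indicator {a..b} (\<omega> e) + real (length (filter (\<lambda>e. \<omega> e \<in> {a..b}) es)))"
      by (auto simp: indicator_def)
    then show ?case
      by (simp only:) (intro borel_measurable_add Cons, measurable)
  qed simp
  then have "(\<lambda>\<omega>. real (length (filter (\<lambda>e. \<omega> e \<in> {a..b}) (path_edges p))) / real (length (path_edges p)))
      \<in> borel_measurable (fpp_measure d \<mu>)" for p
    by (intro borel_measurable_divide borel_measurable_const)
  \<comment> \<open>The ratio is measurable for every fixed path, and the random path takes
    countably many values.\<close>
  from measurable_compose_countable[OF this measurable_first_geodesic[OF assms]]
  show ?thesis by (simp add: nu_def Let_def)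
qed

lemma nu_bounds: "0 \<le> nu d ord \<omega> x B" "nu d ord \<omega> x B \<le> 1"
  by (auto simp: nu_def Let_def divide_le_eq_1)

subsection \<open>The association inequality\<close>

text \<open>The constant \<open>h b\<close> separates the two parts: \<open>h\<close> is at least
  \<open>h b\<close> on \<open>{r..b}\<close> and at most \<open>h b\<close> off it, where almost
  every \<open>t\<close> exceeds \<open>b\<close>. Cross-multiplication avoids subtraction in
  \<open>ennreal\<close>.\<close>

lemma nn_integral_antimono_initial_segment:
  fixes h :: "real \<Rightarrow> ennreal"
  assumes "prob_space \<mu>" and sets: "sets \<mu> = sets borel" and "AE t in \<mu>. r \<le> t"
    and "antimono h" and h: "h \<in> borel_measurable \<mu>"
  shows "emeasure \<mu> {r..b} * (\<integral>\<^sup>+t. h t \<partial>\<mu>) \<le> (\<integral>\<^sup>+t. h t * indicator {r..b} t \<partial>\<mu>)"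
proof -
  interpret prob_space \<mu> by fact
  note h[measurable]
  have space: "space \<mu> = UNIV"
    using sets_eq_imp_space_eq[OF sets] by simp
  let ?I = "{r..b}"
  have I[measurable]: "?I \<in> sets \<mu>" "- ?I \<in> sets \<mu>"
    by (simp_all add: sets)
  let ?A = "\<integral>\<^sup>+t. h t * indicator ?I t \<partial>\<mu>" and ?B = "\<integral>\<^sup>+t. h t * indicator (- ?I) t \<partial>\<mu>"
  let ?a = "emeasure \<mu> ?I" and ?b = "emeasure \<mu> (- ?I)"
  have "?a + ?b = emeasure \<mu> (?I \<union> - ?I)"
    by (rule plus_emeasure) auto
  then have ab: "?a + ?b = 1"
    using emeasure_space_1 space by simp
  have "(\<integral>\<^sup>+t. h t \<partial>\<mu>) = (\<integral>\<^sup>+t. h t * indicator ?I t + h t * indicator (- ?I) t \<partial>\<mu>)"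
    by (intro nn_integral_cong) (auto simp: indicator_def)
  then have split: "(\<integral>\<^sup>+t. h t \<partial>\<mu>) = ?A + ?B"
    by (subst (asm) nn_integral_add) auto
  have "h b * ?a = (\<integral>\<^sup>+t. h b * indicator ?I t \<partial>\<mu>)"
    by (simp add: nn_integral_cmult_indicator)
  also have "\<dots> \<le> ?A"
    using \<open>antimono h\<close> by (intro nn_integral_mono) (auto simp: indicator_def antimono_def)
  finally have A: "h b * ?a \<le> ?A" .
  have "?B \<le> (\<integral>\<^sup>+t. h b * indicator (- ?I) t \<partial>\<mu>)"
  proof (rule nn_integral_mono_AE)
    show "AE t in \<mu>. h t * indicator (- ?I) t \<le> h b * indicator (- ?I) t"
      using assms(3) by eventually_elim (use \<open>antimono h\<close> in \<open>auto simp: indicator_def antimono_def\<close>)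
  qed
  also have "\<dots> = h b * ?b"
    by (rule nn_integral_cmult_indicator) auto
  finally have B: "?B \<le> h b * ?b" .
  have "?a * ?B \<le> ?a * (h b * ?b)"
    using B by (intro mult_left_mono) auto
  also have "\<dots> = h b * ?a * ?b"
    by (simp add: ac_simps)
  also have "\<dots> \<le> ?A * ?b"
    using A by (intro mult_right_mono) auto
  \<comment> \<open>After adding \<open>?a * ?A\<close>, the right side is
    \<open>?A * (?a + ?b)\<close>, which equals \<open>?A\<close>.\<close>
  finally have "?a * (?A + ?B) \<le> ?a * ?A + ?A * ?b"
    by (simp add: distrib_left add_left_mono)
  also have "\<dots> = ?A"
    using ab by (simp add: mult.commute[of ?A] distrib_right[symmetric])
  finally show ?thesis using split by simp
qed

section \<open>Resampling one edge weight, and the shares of the edges in the first geodesic\<close>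

lemma nn_integral_fpp_resample:
  assumes "prob_space \<mu>" and e: "e \<in> edges d" and f[measurable]: "f \<in> borel_measurable (fpp_measure d \<mu>)"
  shows "(\<integral>\<^sup>+\<omega>. f \<omega> \<partial>fpp_measure d \<mu>) =
    (\<integral>\<^sup>+X. \<integral>\<^sup>+t. f (X(e := t)) \<partial>\<mu> \<partial>PiM (edges d - {e}) (\<lambda>_. \<mu>))"
proof -
  let ?R = "PiM (edges d - {e}) (\<lambda>_. \<mu>)"
  have ins: "insert e (edges d - {e}) = edges d" using e by auto
  interpret M: prob_space \<mu> by fact
  interpret R: prob_space ?R by (intro prob_space_PiM assms)
  interpret pair_sigma_finite \<mu> ?R ..
  \<comment> \<open>The weight of \<open>e\<close> is independent of the others, so gluing it to
    them reproduces the full product measure; Tonelli then splits the integral.\<close>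
  have D: "distr (\<mu> \<Otimes>\<^sub>M ?R) (fpp_measure d \<mu>) (\<lambda>(t, X). X(e := t)) = fpp_measure d \<mu>"
    using distr_pair_PiM_eq_PiM[of "edges d - {e}" "\<lambda>_. \<mu>" e] assms(1) unfolding ins fpp_measure_def by simp
  have m[measurable]: "(\<lambda>(t, X). X(e := t)) \<in> \<mu> \<Otimes>\<^sub>M ?R \<rightarrow>\<^sub>M fpp_measure d \<mu>"
  proof -
    have "(\<lambda>(t, X). X(e := t)) \<in> \<mu> \<Otimes>\<^sub>M ?R \<rightarrow>\<^sub>M PiM (insert e (edges d - {e})) (\<lambda>_. \<mu>)"
      by measurable
    then show ?thesis unfolding ins fpp_measure_def .
  qed
  have "(\<integral>\<^sup>+\<omega>. f \<omega> \<partial>fpp_measure d \<mu>) = (\<integral>\<^sup>+z. f ((\<lambda>(t, X). X(e := t)) z) \<partial>(\<mu> \<Otimes>\<^sub>M ?R))"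
    by (subst D[symmetric]) (rule nn_integral_distr[OF m], simp)
  also have "\<dots> = (\<integral>\<^sup>+X. \<integral>\<^sup>+t. f (X(e := t)) \<partial>\<mu> \<partial>?R)"
    by (subst nn_integral_snd[symmetric]) auto
  finally show ?thesis .
qed

text \<open>Testing \<open>geodesic\<close> sets the share to 0 where \<open>arg_min\<close> returns
  a junk list, so monotonicity in the weight of \<open>e\<close> holds for every
  configuration.\<close>

definition edge_share ::
  "nat \<Rightarrow> (int list list \<Rightarrow> nat) \<Rightarrow> int list \<Rightarrow> int list set \<Rightarrow> (int list set \<Rightarrow> real) \<Rightarrow> real" where
  "edge_share d ord x e \<omega> = (let \<pi> = first_geodesic d ord \<omega> x in
     if geodesic d \<omega> x \<pi> \<and> e \<in> set (path_edges \<pi>) then 1 / real (length (path_edges \<pi>)) else 0)"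

lemma edge_share_nonneg: "0 \<le> edge_share d ord x e \<omega>"
  by (simp add: edge_share_def Let_def)

lemma measurable_edge_share:
  assumes sets: "sets \<mu> = sets borel" and "inj ord"
  shows "edge_share d ord x e \<in> borel_measurable (fpp_measure d \<mu>)"
proof -
  note pred_geodesic[OF sets, measurable]
  have "(\<lambda>\<omega>. if geodesic d \<omega> x p \<and> e \<in> set (path_edges p) then 1 / real (length (path_edges p)) else 0)
      \<in> borel_measurable (fpp_measure d \<mu>)" for p
    by measurable
  from measurable_compose_countable[OF this measurable_first_geodesic[OF assms]]
  show ?thesis by (simp add: edge_share_def[abs_def] Let_def)
qed

text \<open>If \<open>e\<close> is on the first geodesic at weight \<open>t\<close>, lowering the
  weight keeps that geodesic and hence the share. Otherwise the share at \<open>t\<close> is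
  0.\<close>

lemma edge_share_antimono:
  assumes "inj ord"
  shows "antimono (\<lambda>t. edge_share d ord x e (X(e := t)))"
proof (rule antimonoI)
  fix s t :: real assume "s \<le> t"
  show "edge_share d ord x e (X(e := t)) \<le> edge_share d ord x e (X(e := s))"
  proof (cases "geodesic d (X(e := t)) x (first_geodesic d ord (X(e := t)) x) \<and>
      e \<in> set (path_edges (first_geodesic d ord (X(e := t)) x))")
    case True
    then show ?thesis
      using first_geodesic_lower[OF assms \<open>s \<le> t\<close>, of d X e x] by (simp add: edge_share_def)
  next
    case False
    then have "edge_share d ord x e (X(e := t)) = 0"
      by (auto simp: edge_share_def Let_def)
    then show ?thesis by (simp add: edge_share_nonneg)
  qed
qed

lemma nn_integral_edge_share_ge:
  assumes \<mu>: "prob_space \<mu>" and sets: "sets \<mu> = sets borel" and r: "AE t in \<mu>. r \<le> t"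
    and "inj ord" and e: "e \<in> edges d"
  shows "emeasure \<mu> {r..b} * (\<integral>\<^sup>+\<omega>. ennreal (edge_share d ord x e \<omega>) \<partial>fpp_measure d \<mu>) \<le>
    (\<integral>\<^sup>+\<omega>. ennreal (edge_share d ord x e \<omega>) * indicator {r..b} (\<omega> e) \<partial>fpp_measure d \<mu>)"
proof -
  note measurable_edge_share[OF sets \<open>inj ord\<close>, measurable]
  note measurable_fpp_component[OF sets, measurable]
  let ?R = "PiM (edges d - {e}) (\<lambda>_. \<mu>)"
  let ?h = "\<lambda>X t. ennreal (edge_share d ord x e (X(e := t)))"
  interpret M: prob_space \<mu> by fact
  have ins: "insert e (edges d - {e}) = edges d" using e by auto
  have up: "(\<lambda>(X, t). X(e := t)) \<in> ?R \<Otimes>\<^sub>M \<mu> \<rightarrow>\<^sub>M fpp_measure d \<mu>"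
  proof -
    have "(\<lambda>(X, t). X(e := t)) \<in> ?R \<Otimes>\<^sub>M \<mu> \<rightarrow>\<^sub>M PiM (insert e (edges d - {e})) (\<lambda>_. \<mu>)"
      by measurable
    then show ?thesis unfolding ins fpp_measure_def .
  qed
  have meas: "(\<lambda>(X, t). ?h X t) \<in> borel_measurable (?R \<Otimes>\<^sub>M \<mu>)"
    using measurable_compose[OF up, of "\<lambda>\<omega>. ennreal (edge_share d ord x e \<omega>)" borel]
    by (simp add: case_prod_beta')
  then have int: "(\<lambda>X. \<integral>\<^sup>+t. ?h X t \<partial>\<mu>) \<in> borel_measurable ?R"
    by (rule M.borel_measurable_nn_integral)
  have "emeasure \<mu> {r..b} * (\<integral>\<^sup>+\<omega>. ennreal (edge_share d ord x e \<omega>) \<partial>fpp_measure d \<mu>) =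
      emeasure \<mu> {r..b} * (\<integral>\<^sup>+X. \<integral>\<^sup>+t. ?h X t \<partial>\<mu> \<partial>?R)"
    by (subst nn_integral_fpp_resample[OF \<mu> e]) auto
  also have "\<dots> = (\<integral>\<^sup>+X. emeasure \<mu> {r..b} * (\<integral>\<^sup>+t. ?h X t \<partial>\<mu>) \<partial>?R)"
    by (rule nn_integral_cmult[symmetric]) (rule int)
  also have "\<dots> \<le> (\<integral>\<^sup>+X. \<integral>\<^sup>+t. ?h X t * indicator {r..b} t \<partial>\<mu> \<partial>?R)"
  proof (rule nn_integral_mono)
    fix X assume "X \<in> space ?R"
    then have "?h X \<in> borel_measurable \<mu>"
      using measurable_Pair2[OF meas] by simp
    then show "emeasure \<mu> {r..b} * (\<integral>\<^sup>+t. ?h X t \<partial>\<mu>) \<le> (\<integral>\<^sup>+t. ?h X t * indicator {r..b} t \<partial>\<mu>)"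
      using edge_share_antimono[OF \<open>inj ord\<close>, of d x e X]
      by (intro nn_integral_antimono_initial_segment \<mu> sets r)
         (auto simp: antimono_def intro!: ennreal_leI)
  qed
  also have "\<dots> = (\<integral>\<^sup>+\<omega>. ennreal (edge_share d ord x e \<omega>) * indicator {r..b} (\<omega> e) \<partial>fpp_measure d \<mu>)"
    by (subst nn_integral_fpp_resample[OF \<mu> e]) auto
  finally show ?thesis .
qed

text \<open>The first geodesic has distinct edges, all of the same share, and at least one edge as
  \<open>x \<noteq> origin d\<close>. Writing the sums as integrals over a counting measure prepares
  their exchange with expectations.\<close>

lemma
  assumes "geodesic d \<omega> x p" and "x \<noteq> origin d"
  shows sum_edge_share: "(\<integral>\<^sup>+e. ennreal (edge_share d ord x e \<omega>) \<partial>count_space (edges d)) = 1"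
    and sum_edge_share_indicator:
      "(\<integral>\<^sup>+e. ennreal (edge_share d ord x e \<omega>) * indicator B (\<omega> e) \<partial>count_space (edges d)) =
        ennreal (nu d ord \<omega> x B)"
proof -
  define \<pi> where "\<pi> = first_geodesic d ord \<omega> x"
  have g: "geodesic d \<omega> x \<pi>"
    unfolding \<pi>_def using assms(1) by (rule first_geodesic_geodesic)
  then have sa: "sa_path d \<pi> (origin d) x" by (simp add: geodesic_def)
  then have dist: "distinct (path_edges \<pi>)"
    by (intro distinct_path_edges) (simp add: sa_path_def)
  let ?E = "set (path_edges \<pi>)" and ?n = "length (path_edges \<pi>)"
  have sub: "?E \<subseteq> edges d" using sa by (rule sa_path_edges)
  have "?n \<noteq> 0"
  proof
    assume "?n = 0"
    moreover have "\<pi> \<noteq> []" using sa by (simp add: sa_path_def)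
    ultimately obtain a where "\<pi> = [a]"
      by (cases \<pi>) (auto simp: path_edges_def)
    then show False using sa assms(2) by (auto simp: sa_path_def)
  qed
  have share: "edge_share d ord x e \<omega> = (if e \<in> ?E then 1 / real ?n else 0)" for e
    using g by (simp add: edge_share_def \<pi>_def[symmetric])
  have "(\<integral>\<^sup>+e. ennreal (edge_share d ord x e \<omega>) \<partial>count_space (edges d)) = (\<Sum>e\<in>?E. ennreal (1 / real ?n))"
    using sub by (subst nn_integral_count_space'[where A = ?E]) (auto simp: share)
  also have "\<dots> = ennreal (\<Sum>e\<in>?E. 1 / real ?n)"
    by (rule sum_ennreal) simp
  also have "\<dots> = 1"
    using \<open>?n \<noteq> 0\<close> dist by (simp add: distinct_card)
  finally show "(\<integral>\<^sup>+e. ennreal (edge_share d ord x e \<omega>) \<partial>count_space (edges d)) = 1" .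
  have "(\<integral>\<^sup>+e. ennreal (edge_share d ord x e \<omega>) * indicator B (\<omega> e) \<partial>count_space (edges d)) =
      (\<Sum>e\<in>?E. ennreal (1 / real ?n) * indicator B (\<omega> e))"
    using sub by (subst nn_integral_count_space'[where A = ?E]) (auto simp: share)
  also have "\<dots> = (\<Sum>e\<in>?E. ennreal (1 / real ?n * indicator B (\<omega> e)))"
    by (intro sum.cong) (auto simp: indicator_def)
  also have "\<dots> = ennreal (\<Sum>e\<in>?E. 1 / real ?n * indicator B (\<omega> e))"
    by (rule sum_ennreal) simp
  also have "(\<Sum>e\<in>?E. 1 / real ?n * indicator B (\<omega> e)) = (\<Sum>e\<in>?E. indicator B (\<omega> e)) / real ?n"
    by (simp add: sum_divide_distrib)
  also have "(\<Sum>e\<in>?E. indicator B (\<omega> e)) = real (card {e \<in> ?E. \<omega> e \<in> B})"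
    by (simp add: indicator_def sum.If_cases Int_def)
  also have "card {e \<in> ?E. \<omega> e \<in> B} = length (filter (\<lambda>e. \<omega> e \<in> B) (path_edges \<pi>))"
    using distinct_card[OF distinct_filter[OF dist, of "\<lambda>e. \<omega> e \<in> B"]] by simp
  finally show "(\<integral>\<^sup>+e. ennreal (edge_share d ord x e \<omega>) * indicator B (\<omega> e) \<partial>count_space (edges d)) =
      ennreal (nu d ord \<omega> x B)"
    by (simp add: nu_def Let_def \<pi>_def)
qed

text \<open>Tonelli over the countably many edges moves the sum of shares outside the expectation,
  where the one-edge inequality applies, and back inside, where it becomes
  \<open>nu\<close>.\<close>

lemma integral_nu_ge:
  assumes \<mu>: "prob_space \<mu>" and sets: "sets \<mu> = sets borel" and r: "AE t in \<mu>. r \<le> t"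
    and "inj ord" and "x \<noteq> origin d"
    and geod: "AE \<omega> in fpp_measure d \<mu>. \<exists>p. geodesic d \<omega> x p"
  shows "measure \<mu> {r..b} \<le> (\<integral>\<omega>. nu d ord \<omega> x {r..b} \<partial>fpp_measure d \<mu>)"
proof -
  interpret M: prob_space \<mu> by fact
  interpret P: prob_space "fpp_measure d \<mu>" by (rule prob_space_fpp_measure[OF \<mu>])
  let ?P = "fpp_measure d \<mu>" and ?E = "count_space (edges d)"
  let ?s = "\<lambda>e \<omega>. ennreal (edge_share d ord x e \<omega>)"
  note measurable_edge_share[OF sets \<open>inj ord\<close>, measurable]
  note measurable_fpp_component[OF sets, measurable]
  note measurable_nu[OF sets \<open>inj ord\<close>, measurable]
  have "1 = (\<integral>\<^sup>+\<omega>. 1 \<partial>?P)"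
    by (simp add: P.emeasure_space_1)
  also have "\<dots> = (\<integral>\<^sup>+\<omega>. \<integral>\<^sup>+e. ?s e \<omega> \<partial>?E \<partial>?P)"
  proof (rule nn_integral_cong_AE)
    show "AE \<omega> in ?P. 1 = (\<integral>\<^sup>+e. ?s e \<omega> \<partial>?E)"
      using geod by eventually_elim (use sum_edge_share assms(5) in fastforce)
  qed
  also have "\<dots> = (\<integral>\<^sup>+e. \<integral>\<^sup>+\<omega>. ?s e \<omega> \<partial>?P \<partial>?E)"
    by (rule nn_integral_count_space_nn_integral) (auto simp: countable_edges)
  finally have "emeasure \<mu> {r..b} = emeasure \<mu> {r..b} * (\<integral>\<^sup>+e. \<integral>\<^sup>+\<omega>. ?s e \<omega> \<partial>?P \<partial>?E)"
    by simp
  also have "\<dots> = (\<integral>\<^sup>+e. emeasure \<mu> {r..b} * (\<integral>\<^sup>+\<omega>. ?s e \<omega> \<partial>?P) \<partial>?E)"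
    by (rule nn_integral_cmult[symmetric]) simp
  also have "\<dots> \<le> (\<integral>\<^sup>+e. \<integral>\<^sup>+\<omega>. ?s e \<omega> * indicator {r..b} (\<omega> e) \<partial>?P \<partial>?E)"
    by (intro nn_integral_mono nn_integral_edge_share_ge \<mu> sets r \<open>inj ord\<close>) simp
  also have "\<dots> = (\<integral>\<^sup>+\<omega>. \<integral>\<^sup>+e. ?s e \<omega> * indicator {r..b} (\<omega> e) \<partial>?E \<partial>?P)"
    by (rule nn_integral_count_space_nn_integral[symmetric]) (auto simp: countable_edges)
  also have "\<dots> = (\<integral>\<^sup>+\<omega>. ennreal (nu d ord \<omega> x {r..b}) \<partial>?P)"
  proof (rule nn_integral_cong_AE)
    show "AE \<omega> in ?P. (\<integral>\<^sup>+e. ?s e \<omega> * indicator {r..b} (\<omega> e) \<partial>?E) = ennreal (nu d ord \<omega> x {r..b})"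
      using geod by eventually_elim (use sum_edge_share_indicator assms(5) in blast)
  qed
  \<comment> \<open>The bounds 0 and 1 make \<open>nu\<close> integrable, so the Bochner integral is
    not its default value 0.\<close>
  also have "\<dots> = ennreal (\<integral>\<omega>. nu d ord \<omega> x {r..b} \<partial>?P)"
    by (intro nn_integral_eq_integral P.integrable_const_bound[where B = 1])
       (auto simp: nu_bounds)
  finally show ?thesis
    by (simp add: M.emeasure_eq_measure ennreal_le_iff integral_nonneg_AE nu_bounds)
qed

theorem theorem2p5:
  fixes d :: nat and \<mu> :: "real measure" and ord :: "int list list \<Rightarrow> nat"
  assumes "d \<ge> 2"
    and "prob_space \<mu>" and "sets \<mu> = sets borel"
    and "measure \<mu> {..<0} = 0"
    and "ess_inf_r \<mu> = 0 \<Longrightarrow> distrF \<mu> (ess_inf_r \<mu>) < p_c d"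
    and "ess_inf_r \<mu> > 0 \<Longrightarrow> distrF \<mu> (ess_inf_r \<mu>) < oriented_p_c d"
    and "inj ord"
  shows "\<exists>C>0. \<forall>\<epsilon>\<ge>0. \<exists>N::nat. \<forall>x \<in> verts d. l1norm x \<ge> int N \<longrightarrow>
           (\<integral>\<omega>. nu d ord \<omega> x {ess_inf_r \<mu>..ess_inf_r \<mu> + \<epsilon>} \<partial>fpp_measure d \<mu>)
             \<ge> C * measure \<mu> {ess_inf_r \<mu>..ess_inf_r \<mu> + \<epsilon>}"
proof (intro exI[of _ "1::real"] exI[of _ "1::nat"] conjI allI impI ballI)
  fix \<epsilon> :: real and x assume x: "x \<in> verts d" "int 1 \<le> l1norm x"
  \<comment> \<open>\<open>N = 1\<close> excludes only the origin, whose geodesic has no edges, so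
    that \<open>nu\<close> would be 0 / 0 = 0 there.\<close>
  have "l1norm (origin d) = 0"
    by (simp add: l1norm_def origin_def sum_list_replicate)
  then have "x \<noteq> origin d" using x by auto
  then show "1 * measure \<mu> {ess_inf_r \<mu>..ess_inf_r \<mu> + \<epsilon>} \<le>
      (\<integral>\<omega>. nu d ord \<omega> x {ess_inf_r \<mu>..ess_inf_r \<mu> + \<epsilon>} \<partial>fpp_measure d \<mu>)"
    using integral_nu_ge[OF assms(2,3) AE_ess_inf_r_le[OF assms(2-4)] assms(7)]
      AE_ex_geodesic[OF assms(2-5) x(1)] by simp
qed simp

end
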